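(* Let $K\subset\mathbb{C}$ be a field that is finitely generated over $\mathbb{Q}$ and let $n\in\mathbb{N}$. Let $V$ be the set of (restrictions to $K^{*}$ of) additive functions $A\colon K\to\mathbb{C}$ satisfying $$\sum_{i=0}^{n+1}(-1)^{i}\binom{n+1}{i}x^{i}A\left(c\,x^{n+1-i}\right)=0\qquad\text{for all } x\in K,\ c\in K^{*}.$$ Then $V$ contains every additive function $A\colon K\to\mathbb{C}$ satisfying $$\sum_{i=0}^{n}(-1)^{i}\binom{n+1}{i}x^{i}A\left(x^{n+1-i}\right)=0\qquad\text{for all } x\in K;$$ $V$ is a variety on $K^{*}$; every exponential $m\in V$ is the identity, i.e. $m(x)=x$ for all $x\in K^{*}$; and $V$ is spanned by differential operators on $K$.
   Context: $K^{*}$ is the multiplicative group of $K$. The space $\mathbb{C}^{K^{*}}$ of complex valued functions on $K^{*}$ carries the product topology (pointwise convergence). A variety on $K^{*}$ is a closed linear subspace $V\subset\mathbb{C}^{K^{*}}$ which is translation invariant: for every $f\in V$ and $c\in K^{*}$, the function $x\mapsto f(cx)$ belongs to $V$. An additive function $A\colon K\to\mathbb{C}$ satisfies $A(x+y)=A(x)+A(y)$ for all $x,y\in K$, and is identified with its restriction to $K^{*}$. An exponential is a nonzero function $m\colon K^{*}\to\mathbb{C}$ with $m(xy)=m(x)m(y)$ for all $x,y\in K^{*}$. A differential operator on $K$ is a complex linear combination of finitely many mappings of the form $d_1\circ\cdots\circ d_k$, where $d_1,\ldots,d_k$ are derivations on $K$ (additive maps satisfying $d(xy)=d(x)y+xd(y)$);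 for $k=0$ the composition is by convention the identity function. "$V$ is spanned by differential operators" means that $V$ is the smallest closed linear subspace containing the differential operators that belong to $V$, i.e. their linear span is dense in $V$. Convention: $x^0=1$ for all $x\in K$. *)

theory Defs
  imports
    "HOL-Analysis.Analysis"
    "HOL-Algebra.Generated_Fields"
    "HOL-Algebra.Algebraic_Closure_Type"
begin

abbreviation complex_field :: "complex ring" where
  "complex_field \<equiv> ring_of_type_algebra"

definition finitely_generated_over_Rats :: "complex set \<Rightarrow> bool" where
  "finitely_generated_over_Rats K \<longleftrightarrow>
     (\<exists>H. finite H \<and> K = generate_field complex_field (\<rat> \<union> H))"

text \<open>Functions on a set \<open>S\<close> of complex numbers are represented by the extensional functions
  \<open>S \<rightarrow>\<^sub>E UNIV\<close>, so that equality of representatives is equality on \<open>S\<close>; this set is the underlying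
  space of the product topology below. The set \<open>S\<close> is \<open>K - {0}\<close> in the application.\<close>

definition pointwise_topology :: "complex set \<Rightarrow> (complex \<Rightarrow> complex) topology" where
  "pointwise_topology S = product_topology (\<lambda>_. euclidean) S"

definition closed_linear_subspace :: "complex set \<Rightarrow> (complex \<Rightarrow> complex) set \<Rightarrow> bool" where
  "closed_linear_subspace S V \<longleftrightarrow>
     closedin (pointwise_topology S) V \<and>
     (\<lambda>x\<in>S. 0) \<in> V \<and>
     (\<forall>f\<in>V. \<forall>g\<in>V. (\<lambda>x\<in>S. f x + g x) \<in> V) \<and>
     (\<forall>a. \<forall>f\<in>V. (\<lambda>x\<in>S. a * f x) \<in> V)"

definition variety :: "complex set \<Rightarrow> (complex \<Rightarrow> complex) set \<Rightarrow> bool" where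
  "variety K V \<longleftrightarrow>
     closed_linear_subspace (K - {0}) V \<and>
     (\<forall>f\<in>V. \<forall>c\<in>K - {0}. (\<lambda>x\<in>K - {0}. f (c * x)) \<in> V)"

definition additive_on :: "complex set \<Rightarrow> (complex \<Rightarrow> complex) \<Rightarrow> bool" where
  "additive_on K A \<longleftrightarrow> (\<forall>x\<in>K. \<forall>y\<in>K. A (x + y) = A x + A y)"

definition exponential :: "complex set \<Rightarrow> (complex \<Rightarrow> complex) \<Rightarrow> bool" where
  "exponential K m \<longleftrightarrow>
     m \<in> (K - {0}) \<rightarrow>\<^sub>E UNIV \<and>
     (\<exists>x\<in>K - {0}. m x \<noteq> 0) \<and>
     (\<forall>x\<in>K - {0}. \<forall>y\<in>K - {0}. m (x * y) = m x * m y)"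

text \<open>Derivations on \<open>K\<close> take values in \<open>K\<close>, so that they can be composed; the values of \<open>d\<close>
  outside \<open>K\<close> are irrelevant.\<close>

definition derivation :: "complex set \<Rightarrow> (complex \<Rightarrow> complex) \<Rightarrow> bool" where
  "derivation K d \<longleftrightarrow>
     d \<in> K \<rightarrow> K \<and> additive_on K d \<and> (\<forall>x\<in>K. \<forall>y\<in>K. d (x * y) = d x * y + x * d y)"

text \<open>A linear combination is a list of pairs of a coefficient and a word
  \<open>[d\<^sub>1, \<dots>, d\<^sub>k]\<close> of derivations; the word stands for \<open>d\<^sub>1 \<circ> \<dots> \<circ> d\<^sub>k\<close>
  and the empty word for the identity.\<close>

definition differential_operator :: "complex set \<Rightarrow> (complex \<Rightarrow> complex) \<Rightarrow> bool" where
  "differential_operator K D \<longleftrightarrow>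
     (\<exists>ts :: (complex \<times> (complex \<Rightarrow> complex) list) list.
        (\<forall>(a, ds)\<in>set ts. \<forall>d\<in>set ds. derivation K d) \<and>
        (\<forall>x\<in>K. D x = (\<Sum>(a, ds)\<leftarrow>ts. a * foldr (\<circ>) ds id x)))"

definition spanned_by_differential_operators ::
    "complex set \<Rightarrow> (complex \<Rightarrow> complex) set \<Rightarrow> bool" where
  "spanned_by_differential_operators K V \<longleftrightarrow>
     V = \<Inter>{W. closed_linear_subspace (K - {0}) W \<and>
             {restrict D (K - {0}) | D. differential_operator K D} \<inter> V \<subseteq> W}"

end

(* Write (D_x A)(c) = A(xc) - x A(c). The operators D_x commute, and V consists of the additive A
   with D_x^(n+1) A = 0 for all x, equivalently (polarization) with all (n+1)-fold products of
   operators D_x annihilating A. Since D_(xy) = D_x D_y + x D_y + y D_x, the map x |-> D_x A is a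
   derivation modulo functions of order lower by two.

   The derivations from K to C are determined by their values on a finite set of generators of K. For
   a minimal determining set T there are derivations d_t from K to C dual to T, and composing them
   with a K-linear projection from C onto K makes them K-valued; hence every derivation d equals the
   sum of d(t) d_t over t in T. If A is annihilated by (n+1)-fold products, then the Euler-type
   combination n A - sum_t (D_t A) o d_t is annihilated by n-fold products, and so is every D_t A.
   By induction A itself is a differential operator, so no limits are needed for the spanning. *)

theory Submission
  imports Defs
begin

section \<open>The operators D_x, written \<open>mult_diff x\<close>, and the filtration they
  define\<close>

definition mult_diff :: "complex \<Rightarrow> (complex \<Rightarrow> complex) \<Rightarrow> complex \<Rightarrow> complex" where
  "mult_diff x A c = A (x * c) - x * A c"

lemma mult_diff_commute: "mult_diff x (mult_diff y A) = mult_diff y (mult_diff x A)"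
  by (simp add: mult_diff_def fun_eq_iff algebra_simps)

lemma funpow_mult_diff_commute:
  "(mult_diff x ^^ k) (mult_diff y A) = mult_diff y ((mult_diff x ^^ k) A)"
  by (induction k) (simp_all add: mult_diff_commute)

lemma mult_diff_diff:
  "mult_diff x (\<lambda>c. A c - B c) = (\<lambda>c. mult_diff x A c - mult_diff x B c)"
  by (simp add: mult_diff_def fun_eq_iff algebra_simps)

lemma mult_diff_cmult: "mult_diff x (\<lambda>c. b * A c) = (\<lambda>c. b * mult_diff x A c)"
  by (simp add: mult_diff_def fun_eq_iff algebra_simps)

lemma mult_diff_sum:
  "mult_diff x (\<lambda>c. \<Sum>t\<in>T. A t c) = (\<lambda>c. \<Sum>t\<in>T. mult_diff x (A t) c)"
  by (simp add: mult_diff_def fun_eq_iff sum_subtractf sum_distrib_left)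

text \<open>The composite \<open>mult_diff x (mult_diff y A)\<close> is exactly the failure of the
  Leibniz rule for the map sending x to \<open>mult_diff x A c\<close>.\<close>

lemma mult_diff_mult:
  "mult_diff (x * y) A c = mult_diff x (mult_diff y A) c + x * mult_diff y A c + y * mult_diff x A c"
  by (simp add: mult_diff_def algebra_simps)

text \<open>D_x is the difference of two commuting operators, translation by x and multiplication by
  the scalar x, so its powers expand binomially. This turns the equation defining V into the
  vanishing of a power of D_x.\<close>

lemma funpow_mult_diff_sum:
  "(mult_diff x ^^ m) A c = (\<Sum>i=0..m. (-1) ^ i * of_nat (m choose i) * x ^ i * A (c * x ^ (m - i)))"
proof (induction m arbitrary: c)
  case (Suc m)
  define f where "f i = (-1) ^ i * x ^ i * A (c * x ^ (Suc m - i))" for i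
  have "(mult_diff x ^^ Suc m) A c
      = (\<Sum>i=0..m. of_nat (m choose i) * f i) + (\<Sum>i=0..m. of_nat (m choose i) * f (Suc i))"
    unfolding funpow.simps o_def mult_diff_def[of x _ c] Suc sum_distrib_left f_def
      diff_conv_add_uminus sum_negf[symmetric]
    by (intro arg_cong2[of _ _ _ _ "(+)"] sum.cong refl)
       (auto simp: Suc_diff_le mult_ac)
  \<comment> \<open>The added term has coefficient \<open>m choose Suc m\<close>, which is 0.
    Splitting off \<open>f 0\<close> then aligns both sums at \<open>f (Suc i)\<close> for Pascal's
    rule.\<close>
  also have "(\<Sum>i=0..m. of_nat (m choose i) * f i) = (\<Sum>i=0..Suc m. of_nat (m choose i) * f i)"
    by simp
  also have "\<dots> = f 0 + (\<Sum>i=0..m. of_nat (m choose Suc i) * f (Suc i))"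
    by (subst sum.atLeast0_atMost_Suc_shift) simp
  also have "\<dots> + (\<Sum>i=0..m. of_nat (m choose i) * f (Suc i))
      = f 0 + (\<Sum>i=0..m. of_nat (Suc m choose Suc i) * f (Suc i))"
    by (simp add: sum.distrib[symmetric] algebra_simps)
  also have "\<dots> = (\<Sum>i=0..Suc m. of_nat (Suc m choose i) * f i)"
    by (subst sum.atLeast0_atMost_Suc_shift) simp
  finally show ?case by (simp add: f_def mult_ac)
qed simp

text \<open>Products of arbitrary operators D_x are peeled off one factor at a time, which suits
  induction better than powers of a single D_x. The bound is strict, so V appears at level n + 1 and
  inductions start from functions vanishing on K.\<close>

primrec order_lt :: "complex set \<Rightarrow> nat \<Rightarrow> (complex \<Rightarrow> complex) \<Rightarrow> bool" where
  "order_lt K 0 A \<longleftrightarrow> (\<forall>c\<in>K. A c = 0)"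
| "order_lt K (Suc n) A \<longleftrightarrow> additive_on K A \<and> (\<forall>x\<in>K. order_lt K n (mult_diff x A))"

text \<open>Complex values are allowed because the map sending x to \<open>mult_diff x A c\<close>,
  to which this is applied, need not take values in K.\<close>

definition derivation_to_complex :: "complex set \<Rightarrow> (complex \<Rightarrow> complex) \<Rightarrow> bool" where
  "derivation_to_complex K d \<longleftrightarrow>
     additive_on K d \<and> (\<forall>x\<in>K. \<forall>y\<in>K. d (x * y) = d x * y + x * d y)"

section \<open>Closure properties of differential operators\<close>

lemma differential_operator_cong:
  assumes "differential_operator K A" "\<And>x. x \<in> K \<Longrightarrow> A x = B x"
  shows "differential_operator K B"
  using assms unfolding differential_operator_def by auto

lemma differential_operator_zero: "differential_operator K (\<lambda>_. 0)"
  unfolding differential_operator_def by (intro exI[of _ "[]"]) simp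

lemma differential_operator_id: "differential_operator K (\<lambda>x. x)"
  unfolding differential_operator_def by (intro exI[of _ "[(1, [])]"]) simp

lemma differential_operator_add:
  assumes "differential_operator K A" "differential_operator K B"
  shows "differential_operator K (\<lambda>x. A x + B x)"
proof -
  obtain ts us where
    "\<forall>(a, ds)\<in>set ts. \<forall>d\<in>set ds. derivation K d"
    "\<forall>x\<in>K. A x = (\<Sum>(a, ds)\<leftarrow>ts. a * foldr (\<circ>) ds id x)"
    "\<forall>(a, ds)\<in>set us. \<forall>d\<in>set ds. derivation K d"
    "\<forall>x\<in>K. B x = (\<Sum>(a, ds)\<leftarrow>us. a * foldr (\<circ>) ds id x)"
    using assms unfolding differential_operator_def by blast
  then show ?thesis
    unfolding differential_operator_def by (intro exI[of _ "ts @ us"]) auto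
qed

lemma differential_operator_cmult:
  assumes "differential_operator K A"
  shows "differential_operator K (\<lambda>x. b * A x)"
proof -
  obtain ts where ts:
    "\<forall>(a, ds)\<in>set ts. \<forall>d\<in>set ds. derivation K d"
    "\<forall>x\<in>K. A x = (\<Sum>(a, ds)\<leftarrow>ts. a * foldr (\<circ>) ds id x)"
    using assms unfolding differential_operator_def by blast
  show ?thesis
    unfolding differential_operator_def
  proof (intro exI[of _ "map (\<lambda>(a, ds). (b * a, ds)) ts"] conjI)
    show "\<forall>x\<in>K. b * A x = (\<Sum>(a, ds)\<leftarrow>map (\<lambda>(a, ds). (b * a, ds)) ts. a * foldr (\<circ>) ds id x)"
      using ts(2) by (simp add: sum_list_const_mult[symmetric] case_prod_unfold o_def mult.assoc)
  qed (use ts(1) in auto)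
qed

lemma differential_operator_compose_derivation:
  assumes "differential_operator K A" "derivation K d"
  shows "differential_operator K (\<lambda>x. A (d x))"
proof -
  obtain ts where ts:
    "\<forall>(a, ds)\<in>set ts. \<forall>d\<in>set ds. derivation K d"
    "\<forall>x\<in>K. A x = (\<Sum>(a, ds)\<leftarrow>ts. a * foldr (\<circ>) ds id x)"
    using assms unfolding differential_operator_def by blast
  have foldr: "foldr (\<circ>) ds d x = foldr (\<circ>) ds id (d x)" for ds x
    by (induction ds) auto
  show ?thesis
    unfolding differential_operator_def
  proof (intro exI[of _ "map (\<lambda>(a, ds). (a, ds @ [d])) ts"] conjI)
    \<comment> \<open>The expansion of A is known on K alone, so it may be evaluated at
      \<open>d x\<close> only because d maps K to itself.\<close>
    have "d x \<in> K" if "x \<in> K" for x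
      using assms(2) that by (auto simp: derivation_def)
    then show "\<forall>x\<in>K. A (d x) = (\<Sum>(a, ds)\<leftarrow>map (\<lambda>(a, ds). (a, ds @ [d])) ts. a * foldr (\<circ>) ds id x)"
      using ts(2) by (simp add: case_prod_unfold o_def foldr)
  qed (use ts(1) assms(2) in fastforce)
qed

lemma differential_operator_sum:
  assumes "finite T" "\<And>t. t \<in> T \<Longrightarrow> differential_operator K (A t)"
  shows "differential_operator K (\<lambda>x. \<Sum>t\<in>T. A t x)"
  using assms
  by (induction T) (simp_all add: differential_operator_zero differential_operator_add)

section \<open>Additive functions and the operations of \<open>complex_field\<close>\<close>

lemma additive_on_add:
  "additive_on K A \<Longrightarrow> additive_on K B \<Longrightarrow> additive_on K (\<lambda>x. A x + B x)"
  by (simp add: additive_on_def)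

lemma additive_on_cmult: "additive_on K A \<Longrightarrow> additive_on K (\<lambda>x. b * A x)"
  by (simp add: additive_on_def algebra_simps)

lemma additive_on_sum:
  "(\<And>t. t \<in> T \<Longrightarrow> additive_on K (A t)) \<Longrightarrow> additive_on K (\<lambda>x. \<Sum>t\<in>T. A t x)"
  by (simp add: additive_on_def sum.distrib)

lemma complex_field_simps:
  "carrier complex_field = UNIV" "x \<oplus>\<^bsub>complex_field\<^esub> y = x + y"
  "x \<otimes>\<^bsub>complex_field\<^esub> y = x * y" "\<zero>\<^bsub>complex_field\<^esub> = 0" "\<one>\<^bsub>complex_field\<^esub> = 1"
  by (simp_all add: ring_of_type_algebra_def)

lemma complex_field_a_inv: "\<ominus>\<^bsub>complex_field\<^esub> z = - z"
proof -
  interpret ring complex_field by (rule ring_from_type_algebra)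
  show ?thesis by (rule minus_equality) (simp_all add: complex_field_simps)
qed

lemma complex_field_m_inv: "z \<noteq> 0 \<Longrightarrow> inv\<^bsub>complex_field\<^esub> z = inverse z"
proof -
  interpret ring complex_field by (rule ring_from_type_algebra)
  show "inv\<^bsub>complex_field\<^esub> z = inverse z" if "z \<noteq> 0"
    by (rule inv_char) (use that in \<open>simp_all add: complex_field_simps\<close>)
qed

section \<open>Additive functions over a subfield, and polarization\<close>

locale complex_subfield =
  fixes K :: "complex set"
  assumes zero_closed: "0 \<in> K" and one_closed: "1 \<in> K"
    and add_closed: "x \<in> K \<Longrightarrow> y \<in> K \<Longrightarrow> x + y \<in> K"
    and uminus_closed: "x \<in> K \<Longrightarrow> - x \<in> K"
    and mult_closed: "x \<in> K \<Longrightarrow> y \<in> K \<Longrightarrow> x * y \<in> K"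
    and inverse_closed: "x \<in> K \<Longrightarrow> inverse x \<in> K"
begin

lemma of_nat_closed: "of_nat k \<in> K"
  by (induction k) (simp_all add: zero_closed one_closed add_closed)

lemma additive_zero: "additive_on K A \<Longrightarrow> A 0 = 0"
  unfolding additive_on_def using zero_closed by (metis add_cancel_left_left)

lemma additive_uminus: "additive_on K A \<Longrightarrow> x \<in> K \<Longrightarrow> A (- x) = - A x"
  using additive_zero[of A] uminus_closed[of x] unfolding additive_on_def
  by (metis add.right_inverse add_eq_0_iff)

lemma additive_of_nat_mult:
  "additive_on K A \<Longrightarrow> x \<in> K \<Longrightarrow> A (of_nat k * x) = of_nat k * A x"
proof (induction k)
  case (Suc k)
  have "A (of_nat (Suc k) * x) = A (x + of_nat k * x)" by (simp add: algebra_simps)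
  also have "\<dots> = A x + A (of_nat k * x)"
    using Suc.prems of_nat_closed mult_closed by (simp add: additive_on_def)
  finally show ?case using Suc by (simp add: algebra_simps)
qed (simp add: additive_zero)

lemma additive_mult_diff: "additive_on K A \<Longrightarrow> x \<in> K \<Longrightarrow> additive_on K (mult_diff x A)"
  by (simp add: additive_on_def mult_diff_def mult_closed algebra_simps)

lemma funpow_mult_diff_cong:
  assumes "\<And>c. c \<in> K \<Longrightarrow> A c = B c" "x \<in> K" "c \<in> K"
  shows "(mult_diff x ^^ m) A c = (mult_diff x ^^ m) B c"
  using assms by (induction m arbitrary: c) (simp_all add: mult_diff_def mult_closed)

lemma funpow_mult_diff_linear:
  "(mult_diff x ^^ m) (\<lambda>c. A c + b * B c) c = (mult_diff x ^^ m) A c + b * (mult_diff x ^^ m) B c"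
  by (induction m arbitrary: c) (simp_all add: mult_diff_def algebra_simps)

text \<open>On additive functions D_(x+ky) is D_x + k D_y, so its powers are polynomial in k, as in
  the binomial theorem for commuting operators. The linear coefficient isolates the mixed product
  needed for polarization.\<close>

lemma funpow_mult_diff_add_poly:
  assumes "additive_on K A" "x \<in> K" "y \<in> K" "c \<in> K"
  shows "\<exists>q. (\<forall>k::nat. (mult_diff (x + of_nat k * y) ^^ m) A c = poly q (of_nat k)) \<and>
             poly.coeff q 0 = (mult_diff x ^^ m) A c \<and>
             poly.coeff q 1 = of_nat m * (mult_diff x ^^ (m - 1)) (mult_diff y A) c"
  using assms(1)
proof (induction m arbitrary: A)
  case 0
  show ?case by (intro exI[of _ "[:A c:]"]) simp
next
  case (Suc m)
  obtain p where p: "\<And>k::nat. (mult_diff (x + of_nat k * y) ^^ m) (mult_diff x A) c = poly p (of_nat k)"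
      "poly.coeff p 0 = (mult_diff x ^^ m) (mult_diff x A) c"
      "poly.coeff p 1 = of_nat m * (mult_diff x ^^ (m - 1)) (mult_diff y (mult_diff x A)) c"
    using Suc additive_mult_diff assms by metis
  obtain q where q: "\<And>k::nat. (mult_diff (x + of_nat k * y) ^^ m) (mult_diff y A) c = poly q (of_nat k)"
      "poly.coeff q 0 = (mult_diff x ^^ m) (mult_diff y A) c"
    using Suc additive_mult_diff assms by metis
  have "(mult_diff (x + of_nat k * y) ^^ Suc m) A c = poly (p + pCons 0 q) (of_nat k)" for k :: nat
  proof -
    have z: "x + of_nat k * y \<in> K" using assms of_nat_closed mult_closed add_closed by simp
    have "mult_diff (x + of_nat k * y) A c = mult_diff x A c + of_nat k * mult_diff y A c"
      if "c \<in> K" for c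
      using additive_of_nat_mult[OF Suc.prems, of "y * c" k] assms Suc.prems of_nat_closed mult_closed that
      by (simp add: mult_diff_def additive_on_def algebra_simps)
    then have "(mult_diff (x + of_nat k * y) ^^ m) (mult_diff (x + of_nat k * y) A) c
        = (mult_diff (x + of_nat k * y) ^^ m) (\<lambda>c. mult_diff x A c + of_nat k * mult_diff y A c) c"
      using assms z by (intro funpow_mult_diff_cong) auto
    then show ?thesis
      by (simp add: funpow_Suc_right p q funpow_mult_diff_linear del: funpow.simps)
  qed
  \<comment> \<open>The polynomial \<open>p\<close> contributes m copies of the mixed term and
    \<open>q\<close> one more, once the operators are commuted. The case split handles the truncated
    \<open>m - 1\<close> at \<open>m = 0\<close>, where its factor is 0.\<close>
  moreover have "poly.coeff (p + pCons 0 q) 1 = of_nat (Suc m) * (mult_diff x ^^ m) (mult_diff y A) c"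
    using p(3) q(2) by (cases m) (simp_all add: mult_diff_commute[of y x] funpow_swap1 algebra_simps
      funpow_mult_diff_commute)
  ultimately show ?case
    using p(2) by (intro exI[of _ "p + pCons 0 q"]) (simp add: funpow_Suc_right del: funpow.simps)
qed

text \<open>A polynomial with every natural number as a root is zero; its linear coefficient
  therefore vanishes, and \<open>Suc m\<close> can be cancelled. The point c stays fixed, so the
  argument also serves an equation known only at 1.\<close>

lemma mult_diff_polarize:
  assumes "additive_on K A" "c \<in> K" "x \<in> K" "y \<in> K"
    and vanish: "\<And>x. x \<in> K \<Longrightarrow> (mult_diff x ^^ Suc m) A c = 0"
  shows "(mult_diff x ^^ m) (mult_diff y A) c = 0"
proof -
  obtain q where q: "\<And>k::nat. (mult_diff (x + of_nat k * y) ^^ Suc m) A c = poly q (of_nat k)"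
      "poly.coeff q 1 = of_nat (Suc m) * (mult_diff x ^^ m) (mult_diff y A) c"
    using funpow_mult_diff_add_poly[OF assms(1,3,4,2), of "Suc m"] by auto
  have "poly q (of_nat k) = 0" for k :: nat
    using vanish[of "x + of_nat k * y"] q(1) assms of_nat_closed mult_closed add_closed by simp
  then have "range (of_nat :: nat \<Rightarrow> complex) \<subseteq> {z. poly q z = 0}" by auto
  moreover have "infinite (range (of_nat :: nat \<Rightarrow> complex))"
    using infinite_UNIV_char_0 finite_imageD inj_of_nat by blast
  ultimately have "q = 0" using poly_roots_finite finite_subset by blast
  then show ?thesis using q(2) by (simp del: of_nat_Suc)
qed

section \<open>The order filtration\<close>

lemma order_lt_funpow:
  "order_lt K m A \<Longrightarrow> x \<in> K \<Longrightarrow> c \<in> K \<Longrightarrow> (mult_diff x ^^ m) A c = 0"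
  by (induction m arbitrary: A) (simp_all add: funpow_Suc_right del: funpow.simps(2))

text \<open>Polarization replaces one factor of a power at a time by an arbitrary
  \<open>mult_diff y\<close>, so powers of single operators control all products.\<close>

lemma order_lt_iff:
  assumes "additive_on K A"
  shows "order_lt K m A \<longleftrightarrow> (\<forall>x\<in>K. \<forall>c\<in>K. (mult_diff x ^^ m) A c = 0)"
proof
  assume "\<forall>x\<in>K. \<forall>c\<in>K. (mult_diff x ^^ m) A c = 0"
  then show "order_lt K m A"
    using assms
  proof (induction m arbitrary: A)
    case 0
    then show ?case using one_closed by auto
  next
    case (Suc m)
    then show ?case
      using mult_diff_polarize additive_mult_diff by auto
  qed
qed (simp add: order_lt_funpow)

lemma order_lt_additive: "order_lt K n A \<Longrightarrow> additive_on K A"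
  by (cases n) (auto simp: additive_on_def add_closed)

lemma order_lt_cong:
  assumes "\<And>c. c \<in> K \<Longrightarrow> A c = B c" "order_lt K n A"
  shows "order_lt K n B"
  using assms
proof (induction n arbitrary: A B)
  case (Suc n)
  have "order_lt K n (mult_diff x B)" if "x \<in> K" for x
  proof (rule Suc.IH)
    show "order_lt K n (mult_diff x A)" using Suc.prems that by simp
  qed (simp add: mult_diff_def mult_closed Suc.prems that)
  moreover have "additive_on K B"
    using Suc.prems add_closed by (simp add: additive_on_def)
  ultimately show ?case by simp
qed simp

lemma order_lt_add: "order_lt K n A \<Longrightarrow> order_lt K n B \<Longrightarrow> order_lt K n (\<lambda>c. A c + B c)"
proof (induction n arbitrary: A B)
  case (Suc n)
  have "mult_diff x (\<lambda>c. A c + B c) = (\<lambda>c. mult_diff x A c + mult_diff x B c)" for x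
    by (simp add: mult_diff_def fun_eq_iff algebra_simps)
  then show ?case using Suc by (simp add: additive_on_add)
qed simp

lemma order_lt_cmult: "order_lt K n A \<Longrightarrow> order_lt K n (\<lambda>c. b * A c)"
proof (induction n arbitrary: A)
  case (Suc n)
  then show ?case by (simp add: additive_on_cmult mult_diff_cmult)
qed simp

lemma order_lt_zero: "order_lt K n (\<lambda>_. 0)"
  by (induction n) (simp_all add: additive_on_def mult_diff_def[abs_def])

lemma order_lt_sum:
  assumes "finite T" "\<And>t. t \<in> T \<Longrightarrow> order_lt K n (A t)"
  shows "order_lt K n (\<lambda>x. \<Sum>t\<in>T. A t x)"
  using assms by (induction T) (simp_all add: order_lt_zero order_lt_add)

lemma order_lt_Suc: "order_lt K n A \<Longrightarrow> order_lt K (Suc n) A"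
proof (induction n arbitrary: A)
  case 0
  then show ?case by (simp add: additive_on_def mult_diff_def mult_closed add_closed)
next
  case (Suc n)
  then have "order_lt K (Suc n) (mult_diff x A)" if "x \<in> K" for x
    using that by simp
  then show ?case
    unfolding order_lt.simps(2)[of K "Suc n"] using Suc.prems order_lt_additive by blast
qed

lemma order_lt_mult_diff: "order_lt K n A \<Longrightarrow> x \<in> K \<Longrightarrow> order_lt K n (mult_diff x A)"
  using order_lt_Suc by auto

text \<open>Translation by x is \<open>mult_diff x\<close> plus multiplication by the scalar x, and
  both preserve the order bound.\<close>

lemma order_lt_translate:
  assumes "order_lt K n A" "x \<in> K"
  shows "order_lt K n (\<lambda>c. A (x * c))"
  using order_lt_add[OF order_lt_mult_diff[OF assms] order_lt_cmult[OF assms(1), of x]]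
  by (simp add: mult_diff_def)

text \<open>Polarizing at 1 frees one factor, and the product formula for D_(cx) then moves the base
  point from 1 to c. This is how the equation without the parameter c implies the one with
  it.\<close>

lemma order_lt_of_vanishing_at_one:
  assumes A: "additive_on K A"
    and vanish: "\<And>x. x \<in> K \<Longrightarrow> (mult_diff x ^^ Suc n) A 1 = 0"
  shows "order_lt K (Suc n) A"
proof -
  have mixed: "(mult_diff x ^^ n) (mult_diff y A) 1 = 0" if "x \<in> K" "y \<in> K" for x y
    using mult_diff_polarize[OF A one_closed that vanish] .
  have "(mult_diff x ^^ Suc n) A c = 0" if "x \<in> K" "c \<in> K" for x c
  proof -
    define B where "B = (mult_diff x ^^ n) A"
    have B: "mult_diff y B 1 = 0" if "y \<in> K" for y
      using mixed[OF \<open>x \<in> K\<close> that] by (simp add: B_def funpow_mult_diff_commute)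
    \<comment> \<open>In \<open>mult_diff_mult\<close> at 1 every other term is a multiple of some
      \<open>mult_diff y B 1\<close>, hence 0. Unfolding the outer operator leaves
      \<open>mult_diff x B c - c * mult_diff x B 1\<close>, whose second term is 0 as well.\<close>
    have "mult_diff c (mult_diff x B) 1 = 0"
      using mult_diff_mult[of c x B 1] B that mult_closed by simp
    then show ?thesis
      using B[OF \<open>x \<in> K\<close>] by (simp add: mult_diff_def[of c] B_def)
  qed
  then show ?thesis using order_lt_iff[OF A] by blast
qed

section \<open>A \<open>K\<close>-linear projection of the complex numbers onto
  \<open>K\<close>\<close>

lemma exists_linear_projection:
  obtains \<pi> :: "complex \<Rightarrow> complex"
  where "\<And>z. \<pi> z \<in> K" "\<And>y z. \<pi> (y + z) = \<pi> y + \<pi> z"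
    "\<And>k z. k \<in> K \<Longrightarrow> \<pi> (k * z) = k * \<pi> z" "\<And>k. k \<in> K \<Longrightarrow> \<pi> k = k"
proof -
  \<comment> \<open>A complement of K is found by Zorn's lemma as a K-subspace maximal among those
    avoiding 1; avoiding 1 amounts to meeting K only in 0.\<close>
  define \<A> where "\<A> = {M. 0 \<in> M \<and> (\<forall>y\<in>M. \<forall>z\<in>M. y + z \<in> M) \<and> (\<forall>k\<in>K. \<forall>z\<in>M. k * z \<in> M) \<and> 1 \<notin> M}"
  have "\<exists>M\<in>\<A>. \<forall>S\<in>\<A>. M \<subseteq> S \<longrightarrow> S = M"
  proof (rule subset_Zorn_nonempty)
    show "\<A> \<noteq> {}" by (auto simp: \<A>_def intro!: exI[of _ "{0}"])
    fix C assume "C \<noteq> {}" and chain: "subset.chain \<A> C"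
    then have C: "C \<subseteq> \<A>" "\<And>S Y. S \<in> C \<Longrightarrow> Y \<in> C \<Longrightarrow> S \<subseteq> Y \<or> Y \<subseteq> S"
      by (auto simp: subset_chain_def)
    have "y + z \<in> \<Union>C" if yz: "y \<in> \<Union>C" "z \<in> \<Union>C" for y z
    proof -
      obtain S Y where "S \<in> C" "Y \<in> C" "y \<in> S" "z \<in> Y" using yz by blast
      then obtain Z where "Z \<in> C" "y \<in> Z" "z \<in> Z" using C(2)[of S Y] by blast
      then have "y + z \<in> Z" using C(1) unfolding \<A>_def by blast
      then show ?thesis using \<open>Z \<in> C\<close> by blast
    qed
    moreover have "0 \<in> \<Union>C" using \<open>C \<noteq> {}\<close> C(1) unfolding \<A>_def by blast
    moreover have "k * z \<in> \<Union>C" if "k \<in> K" "z \<in> \<Union>C" for k z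
      using that C(1) unfolding \<A>_def by blast
    moreover have "1 \<notin> \<Union>C" using C(1) unfolding \<A>_def by blast
    ultimately show "\<Union>C \<in> \<A>" unfolding \<A>_def by blast
  qed
  then obtain M where "M \<in> \<A>" and maximal: "\<And>S. S \<in> \<A> \<Longrightarrow> M \<subseteq> S \<Longrightarrow> S = M" by blast
  then have M: "0 \<in> M" "\<And>y z. y \<in> M \<Longrightarrow> z \<in> M \<Longrightarrow> y + z \<in> M"
      "\<And>k z. k \<in> K \<Longrightarrow> z \<in> M \<Longrightarrow> k * z \<in> M" "1 \<notin> M"
    by (auto simp: \<A>_def)
  have "\<exists>k\<in>K. z - k \<in> M" for z
  proof (cases "z \<in> M")
    case True
    then show ?thesis using zero_closed by force
  next
    case False
    \<comment> \<open>N is the span of M and z. Being strictly larger than M, it must contain 1, and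
      solving \<open>1 = m + k * z\<close> for z exhibits \<open>inverse k\<close> as the
      K-component of z.\<close>
    define N where "N = {m + k * z | m k. m \<in> M \<and> k \<in> K}"
    have "M \<subseteq> N" using zero_closed by (force simp: N_def)
    moreover have "z \<in> N" using M(1) one_closed by (force simp: N_def)
    ultimately have "N \<notin> \<A>" using maximal False by blast
    moreover have "y + w \<in> N" if yw: "y \<in> N" "w \<in> N" for y w
    proof -
      obtain m k m' k' where "y = m + k * z" "w = m' + k' * z" "m \<in> M" "m' \<in> M" "k \<in> K" "k' \<in> K"
        using yw by (auto simp: N_def)
      then have "y + w = (m + m') + (k + k') * z" "m + m' \<in> M" "k + k' \<in> K"
        using M(2) add_closed by (auto simp: algebra_simps)
      then show ?thesis unfolding N_def by blast
    qed
    moreover have "k * w \<in> N" if kw: "k \<in> K" "w \<in> N" for k w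
    proof -
      obtain m k' where "w = m + k' * z" "m \<in> M" "k' \<in> K"
        using kw by (auto simp: N_def)
      then have "k * w = k * m + k * k' * z" "k * m \<in> M" "k * k' \<in> K"
        using M(3) mult_closed kw by (auto simp: algebra_simps)
      then show ?thesis unfolding N_def by blast
    qed
    moreover have "0 \<in> N" using \<open>M \<subseteq> N\<close> M(1) by blast
    ultimately have "1 \<in> N" by (auto simp: \<A>_def)
    then obtain m k where mk: "1 = m + k * z" "m \<in> M" "k \<in> K" by (auto simp: N_def)
    then have "k \<noteq> 0" using M(4) by auto
    then have "z - inverse k = (- inverse k) * m" using mk(1) by (simp add: field_simps)
    then show ?thesis
      using M(3)[OF uminus_closed mk(2)] mk(3) inverse_closed
      by (intro bexI[of _ "inverse k"]) simp_all
  qed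
  then obtain \<pi> where \<pi>: "\<And>z. \<pi> z \<in> K" "\<And>z. z - \<pi> z \<in> M" by metis
  \<comment> \<open>Two K-components of z differ by an element of K lying in M; were it nonzero,
    dividing by it would put 1 into M. Uniqueness yields all algebraic properties of
    \<open>\<pi>\<close>.\<close>
  have unique: "\<pi> z = k" if "k \<in> K" "z - k \<in> M" for z k
  proof (rule ccontr)
    assume "\<pi> z \<noteq> k"
    have "(z - k) + (-1) * (z - \<pi> z) \<in> M"
      by (intro M(2) M(3) uminus_closed one_closed \<pi>(2) that(2))
    then have "inverse (\<pi> z - k) * (\<pi> z - k) \<in> M"
      using M(3)[of "inverse (\<pi> z - k)"] inverse_closed add_closed[of "\<pi> z" "- k"] uminus_closed \<pi>(1) that
      by simp
    then show False using \<open>\<pi> z \<noteq> k\<close> M(4) by simp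
  qed
  show ?thesis
  proof
    show "\<pi> z \<in> K" for z by fact
    show "\<pi> (y + z) = \<pi> y + \<pi> z" for y z
      using M(2)[OF \<pi>(2)[of y] \<pi>(2)[of z]] \<pi>(1) add_closed by (intro unique) (auto simp: algebra_simps)
    show "\<pi> (k * z) = k * \<pi> z" if "k \<in> K" for k z
      using M(3)[OF that \<pi>(2)[of z]] \<pi>(1) mult_closed that by (intro unique) (auto simp: algebra_simps)
    show "\<pi> k = k" if "k \<in> K" for k
      using that M(1) by (intro unique) auto
  qed
qed

section \<open>Complex-valued derivations and a finite dual system\<close>

lemma derivation_to_complex_one: "derivation_to_complex K d \<Longrightarrow> d 1 = 0"
  using one_closed by (force simp: derivation_to_complex_def)

lemma derivation_to_complex_inverse:
  assumes "derivation_to_complex K d" "x \<in> K" "d x = 0"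
  shows "d (inverse x) = 0"
proof (cases "x = 0")
  case False
  then have "d (x * inverse x) = x * d (inverse x)"
    using assms inverse_closed by (auto simp: derivation_to_complex_def simp del: right_inverse)
  then show ?thesis using False derivation_to_complex_one[OF assms(1)] by simp
qed (use assms in simp)

lemma derivation_to_complex_Rats:
  assumes d: "derivation_to_complex K d" and "x \<in> \<rat>"
  shows "d x = 0"
proof -
  have ad: "additive_on K d" using d by (simp add: derivation_to_complex_def)
  have nat: "d (of_nat k) = 0" for k
    using additive_of_nat_mult[OF ad one_closed, of k] derivation_to_complex_one[OF d] by simp
  have int: "d (of_int k) = 0 \<and> of_int k \<in> K" for k
    using nat of_nat_closed uminus_closed additive_uminus[OF ad of_nat_closed]
    by (cases k rule: int_cases2) auto
  obtain a b :: int where "x = of_int a * inverse (of_int b)"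
    using \<open>x \<in> \<rat>\<close> by (metis Rats_cases' divide_inverse)
  then show ?thesis
    using derivation_to_complex_inverse[OF d] int d inverse_closed
    by (auto simp: derivation_to_complex_def)
qed

lemma derivation_to_complex_add_cmult:
  "derivation_to_complex K d \<Longrightarrow> derivation_to_complex K e \<Longrightarrow>
    derivation_to_complex K (\<lambda>x. d x + b * e x)"
  by (simp add: derivation_to_complex_def additive_on_def algebra_simps)

lemma derivation_to_complex_sum:
  assumes "finite T" "\<And>t. t \<in> T \<Longrightarrow> derivation_to_complex K (d t)"
  shows "derivation_to_complex K (\<lambda>x. \<Sum>t\<in>T. b t * d t x)"
  using assms
proof (induction T)
  case (insert t T)
  then show ?case
    using derivation_to_complex_add_cmult[of "\<lambda>x. \<Sum>t\<in>T. b t * d t x" "d t" "b t"]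
    by (simp add: add.commute)
qed (simp add: derivation_to_complex_def additive_on_def)

text \<open>The kernel of a derivation is a field containing \<open>\<rat>\<close>, so it is all of
  K once it contains the generators.\<close>

lemma derivation_to_complex_eq_zero_generators:
  assumes d: "derivation_to_complex K d"
    and K: "K = generate_field complex_field (\<rat> \<union> H)"
    and H: "\<And>h. h \<in> H \<Longrightarrow> d h = 0" and x: "x \<in> K"
  shows "d x = 0"
proof -
  have ad: "additive_on K d" using d by (simp add: derivation_to_complex_def)
  have "x \<in> generate_field complex_field (\<rat> \<union> H)" using x K by simp
  \<comment> \<open>Membership in K is carried through the induction because the rules for d hold
    only there.\<close>
  then have "x \<in> K \<and> d x = 0"
  proof (induction rule: generate_field.induct)
    case one
    then show ?case
      using one_closed derivation_to_complex_one[OF d] by (simp add: complex_field_simps)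
  next
    case (incl h)
    moreover have "h \<in> K" using incl K generate_field.incl by metis
    ultimately show ?case using H derivation_to_complex_Rats[OF d] by auto
  next
    case (a_inv h)
    then show ?case using uminus_closed additive_uminus[OF ad] by (simp add: complex_field_a_inv)
  next
    case (m_inv h)
    then show ?case
      using inverse_closed derivation_to_complex_inverse[OF d] complex_field_m_inv
      by (simp add: complex_field_simps)
  next
    case (eng_add h1 h2)
    then show ?case
      using add_closed ad by (simp add: complex_field_simps additive_on_def)
  next
    case (eng_mult h1 h2)
    then show ?case
      using mult_closed d by (simp add: complex_field_simps derivation_to_complex_def)
  qed
  then show ?thesis by simp
qed

text \<open>Minimality of a determining set T provides, for each t in T, a derivation vanishing on
  the rest of T but not at t. Subtracting from d its expansion leaves a derivation vanishing on T,
  hence on K.\<close>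

lemma exists_dual_derivations:
  assumes "finitely_generated_over_Rats K"
  obtains T D where "finite T" "T \<subseteq> K" "\<And>t. t \<in> T \<Longrightarrow> derivation K (D t)"
    "\<And>d x. derivation_to_complex K d \<Longrightarrow> x \<in> K \<Longrightarrow> d x = (\<Sum>t\<in>T. d t * D t x)"
proof -
  obtain H where "finite H" and K: "K = generate_field complex_field (\<rat> \<union> H)"
    using assms by (auto simp: finitely_generated_over_Rats_def)
  have "H \<subseteq> K" using generate_field.incl[of _ "\<rat> \<union> H" complex_field] K by blast
  define determines where "determines T \<longleftrightarrow>
    (\<forall>d. derivation_to_complex K d \<longrightarrow> (\<forall>t\<in>T. d t = 0) \<longrightarrow> (\<forall>x\<in>K. d x = 0))" for T
  have "determines H"
    unfolding determines_def using derivation_to_complex_eq_zero_generators[OF _ K] by blast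
  then obtain T where T: "T \<subseteq> H" "determines T" and minimal: "\<And>S. S \<subset> T \<Longrightarrow> \<not> determines S"
  proof -
    have "finite {T. T \<subseteq> H \<and> determines T}" "{T. T \<subseteq> H \<and> determines T} \<noteq> {}"
      using \<open>finite H\<close> \<open>determines H\<close> by auto
    then obtain T where "T \<in> {T. T \<subseteq> H \<and> determines T}"
        "\<And>S. S \<in> {T. T \<subseteq> H \<and> determines T} \<Longrightarrow> S \<subseteq> T \<Longrightarrow> T = S"
      using finite_has_minimal[of "{T. T \<subseteq> H \<and> determines T}"] by metis
    then show ?thesis using that[of T] by blast
  qed
  have "finite T" "T \<subseteq> K" using T \<open>finite H\<close> \<open>H \<subseteq> K\<close> finite_subset by auto
  obtain \<pi> where \<pi>: "\<And>z. \<pi> z \<in> K" "\<And>y z. \<pi> (y + z) = \<pi> y + \<pi> z"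
      "\<And>k z. k \<in> K \<Longrightarrow> \<pi> (k * z) = k * \<pi> z" "\<And>k. k \<in> K \<Longrightarrow> \<pi> k = k"
    using exists_linear_projection by metis
  have "\<exists>D. derivation K D \<and> (\<forall>s\<in>T. D s = (if s = t then 1 else 0))" if "t \<in> T" for t
  proof -
    have "\<not> determines (T - {t})" using minimal that by blast
    then obtain d where d: "derivation_to_complex K d" "\<And>s. s \<in> T - {t} \<Longrightarrow> d s = 0"
        "\<not> (\<forall>x\<in>K. d x = 0)"
      by (auto simp: determines_def)
    then have "d t \<noteq> 0" using T(2) unfolding determines_def by blast
    \<comment> \<open>Division normalizes the value at t to 1, and \<open>\<pi>\<close> brings the
      values into K. The Leibniz rule survives because its coefficients x and y lie in K and pass
      through \<open>\<pi>\<close>.\<close>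
    define D where "D x = \<pi> (d x / d t)" for x
    have "D (x * y) = D x * y + x * D y" if "x \<in> K" "y \<in> K" for x y
    proof -
      have "d (x * y) / d t = y * (d x / d t) + x * (d y / d t)"
        using d(1) that by (simp add: derivation_to_complex_def add_divide_distrib mult.commute)
      then have "D (x * y) = \<pi> (y * (d x / d t) + x * (d y / d t))" by (simp only: D_def)
      also have "\<dots> = y * D x + x * D y" using that by (simp only: D_def \<pi>(2,3))
      finally show ?thesis by (simp add: mult.commute)
    qed
    moreover have "additive_on K D"
      using d(1) \<pi>(2) by (simp add: derivation_to_complex_def additive_on_def D_def add_divide_distrib)
    moreover have "D s = (if s = t then 1 else 0)" if "s \<in> T" for s
      using d(2)[of s] \<open>d t \<noteq> 0\<close> that \<pi>(4)[OF zero_closed] \<pi>(4)[OF one_closed] by (simp add: D_def)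
    ultimately show ?thesis
      using \<pi>(1) by (intro exI[of _ D]) (auto simp: derivation_def D_def)
  qed
  then obtain D where D: "\<And>t. t \<in> T \<Longrightarrow> derivation K (D t)"
      "\<And>t s. t \<in> T \<Longrightarrow> s \<in> T \<Longrightarrow> D t s = (if s = t then 1 else 0)"
    by metis
  show ?thesis
  proof (rule that[OF \<open>finite T\<close> \<open>T \<subseteq> K\<close> D(1)])
    fix d x assume d: "derivation_to_complex K d" and "x \<in> K"
    define e where "e x = d x + (-1) * (\<Sum>t\<in>T. d t * D t x)" for x
    have "derivation_to_complex K e"
      unfolding e_def using d D(1) \<open>finite T\<close>
      by (intro derivation_to_complex_add_cmult derivation_to_complex_sum)
         (auto simp: derivation_def derivation_to_complex_def)
    moreover have "e s = 0" if "s \<in> T" for s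
    proof -
      have "(\<Sum>t\<in>T. d t * D t s) = (\<Sum>t\<in>T. if s = t then d t else 0)"
        using D(2) that by (intro sum.cong refl) simp
      then show ?thesis using that \<open>finite T\<close> by (simp add: e_def)
    qed
    ultimately have "e x = 0"
      using T(2) \<open>x \<in> K\<close> unfolding determines_def by blast
    then show "d x = (\<Sum>t\<in>T. d t * D t x)" by (simp add: e_def)
  qed
qed

section \<open>Expansion in dual derivations and the Euler relation\<close>

context
  fixes T :: "complex set" and D :: "complex \<Rightarrow> complex \<Rightarrow> complex"
  assumes finite_T: "finite T" and T_subset: "T \<subseteq> K"
    and derivation_D: "\<And>t. t \<in> T \<Longrightarrow> derivation K (D t)"
    and expansion: "\<And>d x. derivation_to_complex K d \<Longrightarrow> x \<in> K \<Longrightarrow> d x = (\<Sum>t\<in>T. d t * D t x)"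
begin

text \<open>If twofold products kill A, the map sending x to \<open>mult_diff x A c\<close> is a
  derivation and its expansion is exact. Higher orders reduce to this, since the difference commutes
  with every \<open>mult_diff y\<close>.\<close>

lemma mult_diff_expansion:
  assumes "order_lt K (Suc (Suc n)) A" "x \<in> K"
  shows "order_lt K n (\<lambda>c. mult_diff x A c - (\<Sum>t\<in>T. D t x * mult_diff t A c))"
  using assms(1)
proof (induction n arbitrary: A)
  case 0
  have "derivation_to_complex K (\<lambda>x. mult_diff x A c)" if "c \<in> K" for c
  proof -
    have "mult_diff x (mult_diff y A) c = 0" if "x \<in> K" "y \<in> K" for x y
      using 0 that \<open>c \<in> K\<close> by simp
    then have "mult_diff (x * y) A c = mult_diff x A c * y + x * mult_diff y A c"
      if "x \<in> K" "y \<in> K" for x y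
      using that by (simp add: mult_diff_mult mult.commute)
    then show ?thesis
      using 0 that mult_closed
      by (simp add: derivation_to_complex_def additive_on_def mult_diff_def[of _ A] algebra_simps)
  qed
  from expansion[OF this \<open>x \<in> K\<close>] show ?case by (simp add: mult.commute)
next
  case (Suc n)
  let ?G = "\<lambda>A c. mult_diff x A c - (\<Sum>t\<in>T. D t x * mult_diff t A c)"
  have A: "additive_on K A" using Suc.prems order_lt_additive by blast
  have "additive_on K (\<lambda>c. mult_diff x A c + (-1) * (\<Sum>t\<in>T. D t x * mult_diff t A c))"
    using T_subset \<open>x \<in> K\<close> A
    by (intro additive_on_add additive_on_cmult additive_on_sum additive_mult_diff) auto
  moreover have "mult_diff y (?G A) = ?G (mult_diff y A)" for y
    by (simp add: mult_diff_diff mult_diff_sum mult_diff_cmult mult_diff_commute)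
  moreover have "order_lt K n (?G (mult_diff y A))" if "y \<in> K" for y
    using Suc.IH[of "mult_diff y A"] Suc.prems that by simp
  ultimately show ?case by simp
qed

text \<open>Analogue of Euler's identity for homogeneous polynomials: \<open>mult_diff t\<close>
  acts like a partial derivative in the symbol \<open>D t\<close>, and composing with
  \<open>D t\<close> multiplies it back. Top-order terms, of degree n, thus cancel.\<close>

lemma euler_defect_order:
  assumes "order_lt K (Suc n) A"
  shows "order_lt K n (\<lambda>c. of_nat n * A c - (\<Sum>t\<in>T. mult_diff t A (D t c)))"
  using assms
proof (induction n arbitrary: A)
  case 0
  have "mult_diff t A (D t c) = 0" if "t \<in> T" "c \<in> K" for t c
  proof -
    have "t \<in> K" "D t c \<in> K"
      using that T_subset derivation_D[OF that(1)] by (auto simp: derivation_def)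
    then show ?thesis using 0 by simp
  qed
  then show ?case by simp
next
  case (Suc n)
  let ?G = "\<lambda>n A c. of_nat n * A c - (\<Sum>t\<in>T. mult_diff t A (D t c))"
  have D_closed: "D t c \<in> K" if "t \<in> T" "c \<in> K" for t c
    using derivation_D[OF that(1)] that(2) by (auto simp: derivation_def)
  have A: "additive_on K A" using Suc.prems order_lt_additive by blast
  have "additive_on K (\<lambda>c. mult_diff t A (D t c))" if "t \<in> T" for t
    using additive_mult_diff[OF A, of t] derivation_D[OF that] D_closed that T_subset
    by (auto simp: additive_on_def derivation_def)
  then have "additive_on K (\<lambda>c. of_nat (Suc n) * A c + (-1) * (\<Sum>t\<in>T. mult_diff t A (D t c)))"
    using A by (intro additive_on_add additive_on_cmult additive_on_sum) auto
  moreover have "order_lt K n (mult_diff x (?G (Suc n) A))" if x: "x \<in> K" for x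
  proof (rule order_lt_cong)
    \<comment> \<open>Applying D_x to the defect gives the defect of D_x A with n in place of
      \<open>Suc n\<close>, the expansion error with the leftover copy of D_x A, and twofold
      products applied to A. Each is of order below n.\<close>
    let ?R = "\<lambda>c. ?G n (mult_diff x A) c
      + ((mult_diff x A c - (\<Sum>t\<in>T. D t x * mult_diff t A c))
      + (-1) * (\<Sum>t\<in>T. mult_diff (D t x) (mult_diff t A) c))"
    show "order_lt K n ?R"
    proof (intro order_lt_add order_lt_cmult order_lt_sum finite_T)
      show "order_lt K n (?G n (mult_diff x A))" using Suc x by simp
      show "order_lt K n (\<lambda>c. mult_diff x A c - (\<Sum>t\<in>T. D t x * mult_diff t A c))"
        using mult_diff_expansion Suc.prems x by blast
      show "order_lt K n (mult_diff (D t x) (mult_diff t A))" if "t \<in> T" for t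
        using Suc.prems that T_subset D_closed x by auto
    qed
    fix c assume c: "c \<in> K"
    have "mult_diff t A (D t (x * c)) = mult_diff t A (c * D t x) + mult_diff t A (x * D t c)"
      if "t \<in> T" for t
      using additive_mult_diff[OF A, of t] derivation_D[OF that] D_closed that T_subset x c mult_closed
      by (auto simp: additive_on_def derivation_def mult.commute)
    then have "mult_diff x (?G (Suc n) A) c = of_nat (Suc n) * mult_diff x A c
        - (\<Sum>t\<in>T. mult_diff t A (c * D t x) + mult_diff t A (x * D t c) - x * mult_diff t A (D t c))"
      by (simp add: mult_diff_def[of x] sum_subtractf sum_distrib_left right_diff_distrib mult_ac)
    also have "(\<Sum>t\<in>T. mult_diff t A (c * D t x) + mult_diff t A (x * D t c) - x * mult_diff t A (D t c))
        = (\<Sum>t\<in>T. mult_diff t (mult_diff x A) (D t c)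
            + (D t x * mult_diff t A c + mult_diff (D t x) (mult_diff t A) c))"
      by (intro sum.cong refl) (simp add: mult_diff_def algebra_simps)
    also have "of_nat (Suc n) * mult_diff x A c - \<dots> = ?R c"
      by (simp add: sum.distrib distrib_right)
    finally show "?R c = mult_diff x (?G (Suc n) A) c" ..
  qed
  ultimately show ?case by simp
qed

text \<open>The Euler relation writes n A as a lower-order defect plus the functions
  \<open>mult_diff t A\<close> composed with \<open>D t\<close>, all covered by induction. Dividing
  by n requires treating \<open>n = 0\<close> separately, where A is a multiple of the
  identity.\<close>

lemma order_lt_imp_differential_operator:
  "order_lt K n A \<Longrightarrow> differential_operator K A"
proof (induction n arbitrary: A)
  case 0
  then show ?case using differential_operator_cong[OF differential_operator_zero] by simp
next
  case (Suc n)
  show ?case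
  proof (cases "n = 0")
    case True
    have "A c = A 1 * c" if "c \<in> K" for c
    proof -
      have "mult_diff c A 1 = 0" using Suc.prems True that one_closed by simp
      then show ?thesis by (simp add: mult_diff_def mult.commute)
    qed
    then show ?thesis
      using differential_operator_cong[OF differential_operator_cmult[OF differential_operator_id, of K "A 1"]]
      by simp
  next
    case False
    have "differential_operator K (\<lambda>c. mult_diff t A (D t c))" if "t \<in> T" for t
    proof (rule differential_operator_compose_derivation[OF _ derivation_D[OF that]])
      show "differential_operator K (mult_diff t A)" using Suc that T_subset by auto
    qed
    from differential_operator_add[OF Suc.IH[OF euler_defect_order[OF Suc.prems]]
        differential_operator_sum[OF finite_T, of K "\<lambda>t c. mult_diff t A (D t c)", OF this]]
    have "differential_operator K (\<lambda>c. of_nat n * A c)" by simp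
    from differential_operator_cmult[OF this, of "inverse (of_nat n)"]
    show ?thesis using False by (simp add: mult.assoc[symmetric])
  qed
qed

end

section \<open>The variety of functions of bounded order\<close>

lemma closedin_order_lt:
  assumes "\<And>c. c \<in> K \<Longrightarrow> continuous_map U euclidean (\<lambda>f. \<Phi> f c)"
  shows "closedin U {f \<in> topspace U. order_lt K n (\<Phi> f)}"
proof -
  have closed_eq: "closedin U {f \<in> topspace U. g f = 0}"
    if "continuous_map U euclidean g" for g :: "'a \<Rightarrow> complex"
    using closedin_continuous_map_preimage[OF that, of "{0}"] by simp
  have closed_ball: "closedin U {f \<in> topspace U. \<forall>x\<in>K. P x f}"
    if "\<And>x. x \<in> K \<Longrightarrow> closedin U {f \<in> topspace U. P x f}" for P
  proof -
    have "{f \<in> topspace U. \<forall>x\<in>K. P x f} = (\<Inter>x\<in>K. {f \<in> topspace U. P x f})"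
      using zero_closed by auto
    then show ?thesis using that zero_closed by (auto intro!: closedin_INT)
  qed
  have continuous_cmult: "continuous_map U euclidean (\<lambda>f. b * g f)"
    if "continuous_map U euclidean g" for b :: complex and g :: "'a \<Rightarrow> complex"
    using continuous_map_compose[OF that, of euclidean "\<lambda>z. b * z"]
    by (simp add: o_def continuous_on_mult_left)
  show ?thesis
    using assms
  proof (induction n arbitrary: \<Phi>)
    case 0
    then show ?case by (auto intro!: closed_ball closed_eq)
  next
    case (Suc n)
    have "closedin U {f \<in> topspace U. \<forall>x\<in>K. \<forall>y\<in>K. \<Phi> f (x + y) - (\<Phi> f x + \<Phi> f y) = 0}"
      by (intro closed_ball closed_eq continuous_intros Suc.prems add_closed)
    \<comment> \<open>The induction hypothesis is used with \<open>\<Phi>\<close> followed by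
      \<open>mult_diff x\<close>; a general family \<open>\<Phi>\<close> makes this
      possible.\<close>
    moreover have "closedin U {f \<in> topspace U. \<forall>x\<in>K. order_lt K n (mult_diff x (\<Phi> f))}"
      unfolding mult_diff_def[abs_def]
      by (intro closed_ball Suc.IH continuous_map_diff continuous_cmult Suc.prems mult_closed)
    ultimately have "closedin U ({f \<in> topspace U. \<forall>x\<in>K. \<forall>y\<in>K. \<Phi> f (x + y) - (\<Phi> f x + \<Phi> f y) = 0} \<inter>
        {f \<in> topspace U. \<forall>x\<in>K. order_lt K n (mult_diff x (\<Phi> f))})"
      by (rule closedin_Int)
    then show ?case
      by (rule back_subst[of "closedin U"]) (auto simp: additive_on_def)
  qed
qed

definition order_space :: "nat \<Rightarrow> (complex \<Rightarrow> complex) set" where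
  "order_space n = {restrict A (K - {0}) | A. order_lt K n A}"

lemma order_spaceI: "order_lt K n A \<Longrightarrow> (\<And>x. x \<in> K - {0} \<Longrightarrow> f x = A x) \<Longrightarrow>
    restrict f (K - {0}) \<in> order_space n"
  by (auto simp: order_space_def intro!: exI[of _ A] restrict_ext)

lemma order_spaceE:
  assumes "f \<in> order_space n"
  obtains A where "f = restrict A (K - {0})" "order_lt K n A"
  using assms by (auto simp: order_space_def)

lemma variety_order_space: "variety K (order_space n)"
proof -
  let ?S = "K - {0}" let ?X = "pointwise_topology ?S"
  \<comment> \<open>The topology sees only nonzero arguments; an additive function must be 0 at 0,
    so this is the only candidate for an extension to K.\<close>
  let ?F = "\<lambda>f c. if c = 0 then 0 else f c :: complex"
  have "order_space n = {f \<in> topspace ?X. order_lt K n (?F f)}"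
  proof (intro equalityI subsetI)
    fix f assume "f \<in> order_space n"
    then obtain A where A: "f = restrict A ?S" "order_lt K n A" by (rule order_spaceE)
    have "A c = ?F f c" if "c \<in> K" for c
      using A(1) additive_zero[OF order_lt_additive[OF A(2)]] that by auto
    from order_lt_cong[OF this A(2)] have "order_lt K n (?F f)" .
    moreover have "f \<in> topspace ?X" using A(1) by (simp add: pointwise_topology_def)
    ultimately show "f \<in> {f \<in> topspace ?X. order_lt K n (?F f)}" by blast
  next
    fix f assume f: "f \<in> {f \<in> topspace ?X. order_lt K n (?F f)}"
    then have "restrict f ?S \<in> order_space n" by (intro order_spaceI[of n "?F f"]) auto
    moreover have "restrict f ?S = f"
      using f by (intro PiE_restrict[of f ?S "\<lambda>_. UNIV"]) (simp add: pointwise_topology_def)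
    ultimately show "f \<in> order_space n" by simp
  qed
  moreover have "closedin ?X {f \<in> topspace ?X. order_lt K n (?F f)}"
  proof (rule closedin_order_lt)
    fix c assume "c \<in> K"
    then show "continuous_map ?X euclidean (\<lambda>f. ?F f c)"
      using continuous_map_product_projection[of c ?S "\<lambda>_. euclidean"]
      by (cases "c = 0") (auto simp: pointwise_topology_def)
  qed
  ultimately have "closedin ?X (order_space n)" by simp
  moreover have "(\<lambda>x\<in>?S. f x + g x) \<in> order_space n"
    if "f \<in> order_space n" "g \<in> order_space n" for f g
  proof -
    obtain A B where "f = restrict A ?S" "order_lt K n A" "g = restrict B ?S" "order_lt K n B"
      using \<open>f \<in> _\<close> \<open>g \<in> _\<close> by (elim order_spaceE)
    then show ?thesis by (intro order_spaceI[OF order_lt_add[of n A B]]) auto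
  qed
  moreover have "(\<lambda>x\<in>?S. a * f x) \<in> order_space n" if f: "f \<in> order_space n" for a f
  proof -
    obtain A where "f = restrict A ?S" "order_lt K n A" using f by (rule order_spaceE)
    then show ?thesis by (intro order_spaceI[OF order_lt_cmult[of n A a]]) auto
  qed
  moreover have "(\<lambda>x\<in>?S. f (c * x)) \<in> order_space n" if f: "f \<in> order_space n" and "c \<in> ?S" for c f
  proof -
    obtain A where "f = restrict A ?S" "order_lt K n A" using f by (rule order_spaceE)
    then show ?thesis using \<open>c \<in> ?S\<close> mult_closed
      by (intro order_spaceI[OF order_lt_translate[of n A c]]) auto
  qed
  ultimately show ?thesis
    using order_spaceI[OF order_lt_zero] by (simp add: variety_def closed_linear_subspace_def)
qed

text \<open>An exponential m is an eigenfunction of D_x with eigenvalue m(x) - x. Since the n-th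
  power of D_x kills it and m is nonzero, the eigenvalue is 0.\<close>

lemma exponential_in_order_space:
  assumes "m \<in> order_space n" "exponential K m" "x \<in> K - {0}"
  shows "m x = x"
proof -
  obtain A where A: "m = restrict A (K - {0})" "order_lt K n A" using assms(1) by (rule order_spaceE)
  have mult: "A (y * z) = A y * A z" if "y \<in> K - {0}" "z \<in> K - {0}" for y z
    using assms(2) A(1) that mult_closed by (simp add: exponential_def)
  obtain c where c: "c \<in> K - {0}" "A c \<noteq> 0"
    using assms(2) A(1) by (auto simp: exponential_def)
  have "(mult_diff x ^^ k) A c = (A x - x) ^ k * A c" if "c \<in> K - {0}" for k c
    using that
  proof (induction k arbitrary: c)
    case (Suc k)
    then show ?case
      using assms(3) mult_closed mult by (simp add: mult_diff_def algebra_simps)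
  qed simp
  then have "(A x - x) ^ n * A c = 0"
    using order_lt_funpow[OF A(2), of x c] assms(3) c(1) by simp
  then show ?thesis using c(2) A(1) assms(3) by simp
qed

text \<open>Every member is itself a restricted differential operator, so it lies in each competing
  subspace W, and the space itself is one such W.\<close>

lemma spanned_order_space:
  assumes "finitely_generated_over_Rats K"
  shows "spanned_by_differential_operators K (order_space n)"
proof -
  obtain T D where TD: "finite T" "T \<subseteq> K" "\<And>t. t \<in> T \<Longrightarrow> derivation K (D t)"
    "\<And>d x. derivation_to_complex K d \<Longrightarrow> x \<in> K \<Longrightarrow> d x = (\<Sum>t\<in>T. d t * D t x)"
    using exists_dual_derivations[OF assms] by blast
  have "f \<in> {restrict D (K - {0}) | D. differential_operator K D}" if "f \<in> order_space n" for f
    using that order_lt_imp_differential_operator[OF TD] by (auto simp: order_space_def)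
  then show ?thesis
    using variety_order_space[of n]
    unfolding spanned_by_differential_operators_def variety_def by blast
qed

end

section \<open>Passage from the stated hypotheses to the order filtration\<close>

lemma complex_subfield_of_subfield:
  assumes K: "subfield K complex_field"
  shows "complex_subfield K"
proof
  note props = subringE[OF subfieldE(1)[OF K], unfolded complex_field_simps complex_field_a_inv]
  show "0 \<in> K" "1 \<in> K" by (rule props(2,3))+
  show "x + y \<in> K" if "x \<in> K" "y \<in> K" for x y using that by (rule props(7))
  show "x * y \<in> K" if "x \<in> K" "y \<in> K" for x y using that by (rule props(6))
  show "- x \<in> K" if "x \<in> K" for x using that by (rule props(5))
  show "inverse x \<in> K" if "x \<in> K" for x
    using ring.subfield_m_inv(1)[OF ring_from_type_algebra K, of x] that
    by (cases "x = 0") (simp_all add: complex_field_simps complex_field_m_inv)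
qed

theorem mainTheorem7:
  fixes K :: "complex set" and n :: nat and V :: "(complex \<Rightarrow> complex) set"
  assumes "subfield K complex_field"
    and "finitely_generated_over_Rats K"
    and V_eq: "V = {restrict A (K - {0}) | A. additive_on K A \<and>
      (\<forall>x\<in>K. \<forall>c\<in>K - {0}.
        (\<Sum>i=0..n+1. (-1) ^ i * of_nat ((n + 1) choose i) * x ^ i * A (c * x ^ (n + 1 - i))) = 0)}"
  shows "(\<forall>A. additive_on K A \<and>
            (\<forall>x\<in>K. (\<Sum>i=0..n. (-1) ^ i * of_nat ((n + 1) choose i) * x ^ i * A (x ^ (n + 1 - i))) = 0)
          \<longrightarrow> restrict A (K - {0}) \<in> V)
       \<and> variety K V
       \<and> (\<forall>m\<in>V. exponential K m \<longrightarrow> (\<forall>x\<in>K - {0}. m x = x))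
       \<and> spanned_by_differential_operators K V"
proof -
  interpret complex_subfield K using complex_subfield_of_subfield assms(1) .
  have sum_eq: "(mult_diff x ^^ (n + 1)) A c = 0 \<longleftrightarrow>
      (\<Sum>i=0..n+1. (-1) ^ i * of_nat ((n + 1) choose i) * x ^ i * A (c * x ^ (n + 1 - i))) = 0" for A x c
    unfolding funpow_mult_diff_sum ..
  \<comment> \<open>The equation defining V omits \<open>c = 0\<close>, while
    \<open>order_lt\<close> ranges over all of K; additivity settles the missing point.\<close>
  have vanish_zero: "(mult_diff x ^^ k) A 0 = 0" if "additive_on K A" for A x k
    using additive_zero[OF that] by (induction k) (simp_all add: mult_diff_def)
  have "order_lt K (n + 1) A \<longleftrightarrow> additive_on K A \<and> (\<forall>x\<in>K. \<forall>c\<in>K - {0}.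
        (\<Sum>i=0..n+1. (-1) ^ i * of_nat ((n + 1) choose i) * x ^ i * A (c * x ^ (n + 1 - i))) = 0)" for A
  proof (cases "additive_on K A")
    case True
    have "(\<forall>c\<in>K. (mult_diff x ^^ (n + 1)) A c = 0) \<longleftrightarrow>
        (\<forall>c\<in>K - {0}. (mult_diff x ^^ (n + 1)) A c = 0)" for x
      using vanish_zero[OF True, where x = x and k = "n + 1"] by (metis Diff_iff singletonD)
    then show ?thesis unfolding sum_eq[symmetric] order_lt_iff[OF True] using True by simp
  next
    case False
    then show ?thesis using order_lt_additive by blast
  qed
  then have V: "V = order_space (n + 1)"
    unfolding V_eq order_space_def by simp
  have "restrict A (K - {0}) \<in> V"
    if A: "additive_on K A" and eq: "\<forall>x\<in>K. (\<Sum>i=0..n. (-1) ^ i * of_nat ((n + 1) choose i) * x ^ i * A (x ^ (n + 1 - i))) = 0"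
    for A
  proof -
    \<comment> \<open>The sum in the hypothesis stops at n, so the full binomial sum reduces to its
      last term.\<close>
    have step: "(mult_diff x ^^ Suc n) A 1 = (-1) ^ Suc n * x ^ Suc n * A 1" if "x \<in> K" for x
      using eq that unfolding funpow_mult_diff_sum by simp
    \<comment> \<open>D_1 is the zero operator, so taking \<open>x = 1\<close> forces
      \<open>A 1 = 0\<close>; the last term then vanishes for every x.\<close>
    have "(mult_diff 1 ^^ Suc n) A 1 = 0" by (simp add: mult_diff_def)
    then have "A 1 = 0" using step[OF one_closed] by simp
    then show ?thesis
      unfolding V using order_lt_of_vanishing_at_one[OF A] step by (intro order_spaceI[of _ A]) auto
  qed
  then show ?thesis
    using variety_order_space exponential_in_order_space spanned_order_space[OF assms(2)] V by blast
qed

end
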